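(* Let $\mathcal{H}$ be a hereditary $3$-graph property. If $\overline{H}(k)\in\mathrm{Trip}(\mathcal{H})$ for every $k\geq1$, then $\mathcal{H}$ requires non-zero $\mathrm{vdisc}_3$-error, i.e. $\mathcal{H}$ does not admit zero $\mathrm{vdisc}_3$-error.
   Context: For distinct $x,y,z$ write $xyz=\{x,y,z\}$; $[n]=\{1,\dots,n\}$; $K_3[X,Y,Z]=\{xyz:x\in X,y\in Y,z\in Z\text{ pairwise distinct}\}$. A $3$-graph is a pair $H=(V,F)$ with $F\subseteq\binom V3$. A hereditary $3$-graph property is a class of finite $3$-graphs closed under isomorphism and induced sub-$3$-graphs. An equipartition is a partition whose parts differ in size by at most $1$. Given $H=(V,F)$, $\mathrm{Trip}(H)$ is the $3$-partite $3$-graph with vertex set $\{x_v:v\in V\}\cup\{y_v:v\in V\}\cup\{z_v:v\in V\}$ (three disjoint copies of $V$) and edge set $\{x_vy_{v'}z_{v''}:vv'v''\in F\}$. For a $3$-graph $\Gamma$, $\Gamma\in\mathrm{Trip}(\mathcal{H})$ means that for some $H\in\mathcal{H}$, $\Gamma$ is isomorphic to an induced sub-$3$-graph of $\mathrm{Trip}(H)$. $\overline{H}(k)$ is the $3$-graph with vertex set $\{a_i,b_i,c_i:i\in[k]\}$ ($3k$ distinct vertices) and edge set $\{a_ub_vc_w:u,v,w\in[k],v\leq w\}$. A $3$-partite $3$-graph $(U\cup V\cup W,F)$ with $|F|=d|U||V||W|$ has $\mathrm{vdisc}_3(\epsilon)$ if for all $U'\subseteq U$, $V'\subseteq V$, $W'\subseteq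 W$, $\big||F\cap K_3[U',V',W']|-d|U'||V'||W'|\big|\leq\epsilon|U||V||W|$. $\mathcal{H}$ admits zero $\mathrm{vdisc}_3$-error if for all $\epsilon>0$ and $t_0\geq1$ there are $T,N$ such that for every $H=(V,F)\in\mathcal{H}$ with $|V|\geq N$ there is an equipartition $\mathcal{P}$ of $V$ into $t$ parts, $t_0\leq t\leq T$, such that for every three distinct parts $X,Y,Z\in\mathcal{P}$ the $3$-graph $(X\cup Y\cup Z,F\cap K_3[X,Y,Z])$ has $\mathrm{vdisc}_3(\epsilon)$. *)

theory Defs
  imports Complex_Main "HOL-Library.Disjoint_Sets" "HOL-Library.Ramsey"
begin

text \<open>A 3-graph is a pair of a vertex set and an edge set. The relation \<open>iso\<close> relates 3-graphs whose
  vertices may have different types.\<close>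

type_synonym 'v hgraph = "'v set \<times> 'v set set"

definition three_graph :: "'v hgraph \<Rightarrow> bool" where
  "three_graph H \<longleftrightarrow> snd H \<subseteq> nsets (fst H) 3"

definition iso :: "'v hgraph \<Rightarrow> 'w hgraph \<Rightarrow> bool" where
  "iso G H \<longleftrightarrow> (\<exists>f. bij_betw f (fst G) (fst H) \<and> snd H = (\<lambda>e. f ` e) ` snd G)"

definition induced :: "'v hgraph \<Rightarrow> 'v set \<Rightarrow> 'v hgraph" where
  "induced H U = (U, {e \<in> snd H. e \<subseteq> U})"

text \<open>A class of finite 3-graphs is represented by its members with vertices in a type \<open>'v\<close>. When
  \<open>'v\<close> is infinite, every finite 3-graph has an isomorphic copy there, so a class closed under
  isomorphism is determined by this set.\<close>

definition hereditary_property :: "'v hgraph set \<Rightarrow> bool" where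
  "hereditary_property \<H> \<longleftrightarrow>
     (\<forall>H\<in>\<H>. finite (fst H) \<and> three_graph H) \<and>
     (\<forall>H\<in>\<H>. \<forall>H'. iso H H' \<longrightarrow> H' \<in> \<H>) \<and>
     (\<forall>H\<in>\<H>. \<forall>U. U \<subseteq> fst H \<longrightarrow> induced H U \<in> \<H>)"

definition K3 :: "'v set \<Rightarrow> 'v set \<Rightarrow> 'v set \<Rightarrow> 'v set set" where
  "K3 X Y Z = {{x, y, z} | x y z. x \<in> X \<and> y \<in> Y \<and> z \<in> Z \<and> x \<noteq> y \<and> y \<noteq> z \<and> x \<noteq> z}"

text \<open>Three disjoint copies of a type. In \<open>Trip H\<close> the constructors give $x_v, y_v, z_v$, and in
  \<open>Hbar k\<close> they give $a_i, b_i, c_i$.\<close>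

datatype 'v copy3 = Copy1 'v | Copy2 'v | Copy3 'v

definition Trip :: "'v hgraph \<Rightarrow> 'v copy3 hgraph" where
  "Trip H =
     (Copy1 ` fst H \<union> Copy2 ` fst H \<union> Copy3 ` fst H,
      {{Copy1 v, Copy2 v', Copy3 v''} | v v' v''. {v, v', v''} \<in> snd H})"

definition in_Trip :: "'w hgraph \<Rightarrow> 'v hgraph set \<Rightarrow> bool" where
  "in_Trip \<Gamma> \<H> \<longleftrightarrow> (\<exists>H\<in>\<H>. \<exists>U. U \<subseteq> fst (Trip H) \<and> iso \<Gamma> (induced (Trip H) U))"

definition Hbar :: "nat \<Rightarrow> nat copy3 hgraph" where
  "Hbar k =
     (Copy1 ` {1..k} \<union> Copy2 ` {1..k} \<union> Copy3 ` {1..k},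
      {{Copy1 u, Copy2 v, Copy3 w} | u v w.
         u \<in> {1..k} \<and> v \<in> {1..k} \<and> w \<in> {1..k} \<and> v \<le> w})"

definition tripartite :: "'v set \<Rightarrow> 'v set \<Rightarrow> 'v set \<Rightarrow> 'v set set \<Rightarrow> bool" where
  "tripartite U V W F \<longleftrightarrow>
     U \<inter> V = {} \<and> V \<inter> W = {} \<and> U \<inter> W = {} \<and> F \<subseteq> K3 U V W"

definition vdisc3 :: "real \<Rightarrow> 'v set \<Rightarrow> 'v set \<Rightarrow> 'v set \<Rightarrow> 'v set set \<Rightarrow> bool" where
  "vdisc3 \<epsilon> U V W F \<longleftrightarrow> tripartite U V W F \<and>
     (\<exists>d::real. real (card F) = d * real (card U) * real (card V) * real (card W) \<and>
        (\<forall>U' V' W'. U' \<subseteq> U \<and> V' \<subseteq> V \<and> W' \<subseteq> W \<longrightarrow>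
           \<bar>real (card (F \<inter> K3 U' V' W')) - d * real (card U') * real (card V') * real (card W')\<bar>
             \<le> \<epsilon> * real (card U) * real (card V) * real (card W)))"

definition equipartition :: "'v set \<Rightarrow> 'v set set \<Rightarrow> bool" where
  "equipartition V P \<longleftrightarrow> partition_on V P \<and> (\<forall>X\<in>P. \<forall>Y\<in>P. card X \<le> card Y + 1)"

definition admits_zero_vdisc3_error :: "'v hgraph set \<Rightarrow> bool" where
  "admits_zero_vdisc3_error \<H> \<longleftrightarrow>
     (\<forall>\<epsilon>::real. \<forall>t0::nat. \<epsilon> > 0 \<and> t0 \<ge> 1 \<longrightarrow>
       (\<exists>T N :: nat. \<forall>V F. (V, F) \<in> \<H> \<and> card V \<ge> N \<longrightarrow>
          (\<exists>P. equipartition V P \<and> t0 \<le> card P \<and> card P \<le> T \<and>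
             (\<forall>X\<in>P. \<forall>Y\<in>P. \<forall>Z\<in>P. X \<noteq> Y \<and> Y \<noteq> Z \<and> X \<noteq> Z \<longrightarrow>
                vdisc3 \<epsilon> X Y Z (F \<inter> K3 X Y Z)))))"

end

(* The pattern Hbar(k) inside Trip(H) gives indexed vertices a_i, b_i, c_i of H with a_u b_v c_w an
  edge iff v <= w; restrict H to these. In an equipartition into boundedly many but at least 100
  parts, some part X has at least a third of its vertices among the a_i. For all but a small
  proportion of the cuts s, the part Y containing b_s has a positive proportion of its vertices among
  the b_i with i <= s, and also among the b_i with i > s; likewise for the c_i. Hence some s is such a
  cut both for the b_i in a part Y and for the c_i in a part Z, even after excluding two prescribed
  parts. If Y and Z differ, then (X, Y, Z) has one large subbox of density 1 and one of density 0, so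
  it is not regular. Otherwise repeat with Y excluded, which produces a second part Z and cut s'; say
  s <= s'. The b_i of Y below s with the c_i of Z above s' give density 1, and the c_i of Y below s
  with the b_i of Z above s' give density 0. *)

theory Submission
  imports Defs
begin

section \<open>Recovering indexed vertices from an induced copy in \<open>Trip H\<close>\<close>

primrec part :: "'v copy3 \<Rightarrow> nat" where
  "part (Copy1 v) = 1" | "part (Copy2 v) = 2" | "part (Copy3 v) = 3"

primrec base :: "'v copy3 \<Rightarrow> 'v" where
  "base (Copy1 v) = v" | "base (Copy2 v) = v" | "base (Copy3 v) = v"

lemma copy3_eqI: "part x = part y \<Longrightarrow> base x = base y \<Longrightarrow> x = y"
  by (cases x; cases y) auto

lemma part_range: "part x \<in> {1, 2, 3}"
  by (cases x) auto

text \<open>No order is imposed on \<open>x\<close>, \<open>y\<close>, \<open>z\<close>: an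
  isomorphism onto an induced part of \<open>Trip H\<close> may send the three classes of the
  pattern to the copies in any order.\<close>

lemma Trip_edge_iff:
  "{x, y, z} \<in> snd (Trip H) \<longleftrightarrow>
     part ` {x, y, z} = {1, 2, 3} \<and> {base x, base y, base z} \<in> snd H"
    (is "?L \<longleftrightarrow> ?R")
proof
  assume ?L
  then obtain v v' v'' where e: "{x, y, z} = {Copy1 v, Copy2 v', Copy3 v''}"
    and H: "{v, v', v''} \<in> snd H"
    by (auto simp: Trip_def)
  have "part ` {x, y, z} = {1, 2, 3}"
    unfolding e by simp
  moreover have "base ` {x, y, z} = {v, v', v''}"
    unfolding e by simp
  ultimately show ?R using H by simp
next
  assume R: ?R
  have edge: "{Copy1 v, Copy2 v', Copy3 v''} \<in> snd (Trip H)" if "{v, v', v''} \<in> snd H" for v v' v''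
    using that by (auto simp: Trip_def)
  show ?L
  proof -
    have "1 \<in> part ` {x, y, z}" "2 \<in> part ` {x, y, z}" "3 \<in> part ` {x, y, z}"
      using R by simp_all
    then show ?thesis
      using R edge by (cases x; cases y; cases z) (auto simp: insert_commute)
  qed
qed

lemma Hbar_edge_iff:
  assumes "u \<in> {1..k}" "v \<in> {1..k}" "w \<in> {1..k}"
  shows "{Copy1 u, Copy2 v, Copy3 w} \<in> snd (Hbar k) \<longleftrightarrow> v \<le> w"
proof
  assume "{Copy1 u, Copy2 v, Copy3 w} \<in> snd (Hbar k)"
  then obtain u' v' w' where "{Copy1 u, Copy2 v, Copy3 w} = {Copy1 u', Copy2 v', Copy3 w'}" "v' \<le> w'"
    by (auto simp: Hbar_def)
  moreover from this have "v = v'" "w = w'" by blast+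
  ultimately show "v \<le> w" by simp
next
  assume "v \<le> w"
  then show "{Copy1 u, Copy2 v, Copy3 w} \<in> snd (Hbar k)"
    unfolding Hbar_def snd_conv using assms by blast
qed

lemma iso_induced_edge_iff:
  assumes f: "bij_betw f (fst G) U" and E: "snd (induced H U) = (\<lambda>e. f ` e) ` snd G"
    and G: "\<And>e. e \<in> snd G \<Longrightarrow> e \<subseteq> fst G" and e: "e \<subseteq> fst G"
  shows "e \<in> snd G \<longleftrightarrow> f ` e \<in> snd H"
proof
  assume "e \<in> snd G"
  then have "f ` e \<in> snd (induced H U)" unfolding E by blast
  then show "f ` e \<in> snd H" by (simp add: induced_def)
next
  assume "f ` e \<in> snd H"
  moreover have "f ` e \<subseteq> U" using e f by (auto simp: bij_betw_def)
  ultimately have "f ` e \<in> snd (induced H U)" by (simp add: induced_def)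
  then obtain e' where "e' \<in> snd G" "f ` e = f ` e'" unfolding E by blast
  then show "e \<in> snd G"
    using inj_on_image_eq_iff[of f "fst G" e e'] f e G by (auto simp: bij_betw_def)
qed

text \<open>An embedding need not respect the three classes. Colour each index \<open>i\<close> by
  the copies that receive a_i, b_i, c_i. There are 27 colours, so among \<open>27 * k\<close>
  indices some colour occurs at least \<open>k\<close> times, and on that class each of the three
  families stays inside one copy, where \<open>base\<close> is injective. The images of
  \<open>b\<close> and \<open>c\<close> are not claimed to be disjoint.\<close>

lemma in_Trip_HbarE:
  fixes \<H> :: "'v hgraph set"
  assumes her: "hereditary_property \<H>" and k: "k \<ge> 1" and T: "in_Trip (Hbar (27 * k)) \<H>"
  obtains I :: "nat set" and a b c :: "nat \<Rightarrow> 'v" and F where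
    "(a ` I \<union> b ` I \<union> c ` I, F) \<in> \<H>" "finite I" "k \<le> card I"
    "inj_on a I" "inj_on b I" "inj_on c I"
    "\<And>u v w. u \<in> I \<Longrightarrow> v \<in> I \<Longrightarrow> w \<in> I \<Longrightarrow> {a u, b v, c w} \<in> F \<longleftrightarrow> v \<le> w"
proof -
  define J where "J = {1..27 * k}"
  obtain H U where H: "H \<in> \<H>" and U: "U \<subseteq> fst (Trip H)"
    and iso: "iso (Hbar (27 * k)) (induced (Trip H) U)"
    using T unfolding in_Trip_def by blast
  obtain f where "bij_betw f (fst (Hbar (27 * k))) (fst (induced (Trip H) U))"
    and fE: "snd (induced (Trip H) U) = (\<lambda>e. f ` e) ` snd (Hbar (27 * k))"
    using iso unfolding iso_def by blast
  then have f: "bij_betw f (fst (Hbar (27 * k))) U" by (simp add: induced_def)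
  have inj: "inj_on f (fst (Hbar (27 * k)))" using f by (simp add: bij_betw_def)
  have vert: "Copy1 i \<in> fst (Hbar (27 * k))" "Copy2 i \<in> fst (Hbar (27 * k))"
    "Copy3 i \<in> fst (Hbar (27 * k))" if "i \<in> J" for i
    using that by (auto simp: Hbar_def J_def)
  define col where "col i = (part (f (Copy1 i)), part (f (Copy2 i)), part (f (Copy3 i)))" for i
  define C :: "(nat \<times> nat \<times> nat) set" where "C = {1, 2, 3} \<times> {1, 2, 3} \<times> {1, 2, 3}"
  have "\<exists>q\<in>C. k \<le> card (col -` {q} \<inter> J)"
  proof (rule ccontr)
    assume neg: "\<not> ?thesis"
    have small: "card (col -` {q} \<inter> J) \<le> k - 1" if "q \<in> C" for q
    proof -
      have "\<not> k \<le> card (col -` {q} \<inter> J)" using neg that by blast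
      then show ?thesis by linarith
    qed
    have finC: "finite C" by (simp add: C_def)
    have "col i \<in> C" for i
      unfolding C_def col_def by (simp only: mem_Sigma_iff part_range simp_thms)
    then have "(\<Union>q\<in>C. col -` {q} \<inter> J) = J" by blast
    then have "card J \<le> (\<Sum>q\<in>C. card (col -` {q} \<inter> J))"
      using card_UN_le[OF finC, of "\<lambda>q. col -` {q} \<inter> J"] by simp
    also have "\<dots> \<le> (\<Sum>q\<in>C. k - 1)" by (intro sum_mono small)
    also have "\<dots> = 27 * (k - 1)" by (simp add: C_def)
    finally show False using k by (simp add: J_def)
  qed
  then obtain \<alpha> \<beta> \<gamma> where big: "k \<le> card (col -` {(\<alpha>, \<beta>, \<gamma>)} \<inter> J)" by (metis prod_cases3)
  define I where "I = col -` {(\<alpha>, \<beta>, \<gamma>)} \<inter> J"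
  have IJ: "I \<subseteq> J" and finI: "finite I" and cardI: "k \<le> card I"
    using big by (auto simp: I_def J_def)
  have parts: "part (f (Copy1 i)) = \<alpha>" "part (f (Copy2 i)) = \<beta>" "part (f (Copy3 i)) = \<gamma>"
    if "i \<in> I" for i
    using that by (auto simp: I_def col_def)
  define a b c where "a i = base (f (Copy1 i))" and "b i = base (f (Copy2 i))"
    and "c i = base (f (Copy3 i))" for i
  have trip: "v \<le> w \<longleftrightarrow> {f (Copy1 u), f (Copy2 v), f (Copy3 w)} \<in> snd (Trip H)"
    if "u \<in> I" "v \<in> I" "w \<in> I" for u v w
  proof -
    have range: "u \<in> {1..27 * k}" "v \<in> {1..27 * k}" "w \<in> {1..27 * k}"
      using that IJ unfolding J_def by blast+
    have "{Copy1 u, Copy2 v, Copy3 w} \<in> snd (Hbar (27 * k)) \<longleftrightarrow>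
        f ` {Copy1 u, Copy2 v, Copy3 w} \<in> snd (Trip H)"
      using range by (intro iso_induced_edge_iff[OF f fE]) (auto simp: Hbar_def)
    then show ?thesis by (simp add: Hbar_edge_iff[OF range])
  qed
  have "I \<noteq> {}" using cardI k by auto
  then obtain i where i: "i \<in> I" by blast
  \<comment> \<open>The diagonal triple of index \<open>i\<close> is an edge of the pattern, so its
    image meets all three copies. Hence the colour of the class is a permutation of 1, 2, 3.\<close>
  have abc: "{\<alpha>, \<beta>, \<gamma>} = {1, 2, 3}"
    using trip[OF i i i] by (simp add: Trip_edge_iff parts[OF i])
  have edge: "{a u, b v, c w} \<in> snd H \<longleftrightarrow> v \<le> w" if "u \<in> I" "v \<in> I" "w \<in> I" for u v w
    using trip[OF that] abc that by (simp add: Trip_edge_iff parts a_def b_def c_def)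
  have injs: "inj_on a I" "inj_on b I" "inj_on c I"
  proof -
    have base_inj: "inj_on (\<lambda>i. base (f (g i))) I"
      if g: "inj g" "\<And>i. i \<in> J \<Longrightarrow> g i \<in> fst (Hbar (27 * k))" "\<And>i. i \<in> I \<Longrightarrow> part (f (g i)) = q" for g q
    proof (rule inj_onI)
      fix i j assume ij: "i \<in> I" "j \<in> I" "base (f (g i)) = base (f (g j))"
      then have "f (g i) = f (g j)" using g(3) by (intro copy3_eqI) auto
      then have "g i = g j" using ij g(2) IJ by (intro inj_onD[OF inj]) auto
      then show "i = j" using g(1) by (simp add: inj_eq)
    qed
    show "inj_on a I" "inj_on b I" "inj_on c I"
      unfolding a_def b_def c_def
      by (rule base_inj[OF _ _ parts(1)] base_inj[OF _ _ parts(2)] base_inj[OF _ _ parts(3)];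
          simp add: vert inj_def)+
  qed
  \<comment> \<open>Passing to the indexed vertices alone, by heredity, later bounds the vertex set
    by three times the number of indices.\<close>
  define W where "W = a ` I \<union> b ` I \<union> c ` I"
  have mem: "base x \<in> fst H" if "x \<in> U" for x
    using that U by (cases x) (auto simp: Trip_def)
  have "f x \<in> U" if "x \<in> fst (Hbar (27 * k))" for x
    using that f by (auto simp: bij_betw_def)
  then have "W \<subseteq> fst H"
    using mem vert IJ by (auto simp: W_def a_def b_def c_def)
  then have "induced H W \<in> \<H>"
    using her H unfolding hereditary_property_def by blast
  then have "(W, {e \<in> snd H. e \<subseteq> W}) \<in> \<H>" by (simp add: induced_def)
  then show thesis
    using that[of a I b c "{e \<in> snd H. e \<subseteq> W}"] finI cardI injs edge
    unfolding W_def by auto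
qed

section \<open>Cuts of the index set that divide a part evenly enough\<close>

definition splits :: "nat \<Rightarrow> nat set \<Rightarrow> nat \<Rightarrow> bool" where
  "splits h S s \<longleftrightarrow> h \<le> card {i\<in>S. i \<le> s} \<and> h \<le> card {i\<in>S. s < i}"

text \<open>The failing cuts are few at either end of \<open>S\<close>: all \<open>s\<close> with
  too few elements below lie at or below the largest such \<open>s\<close>, and all with too few
  above lie at or above the smallest such \<open>s\<close>. Each kind contributes at most
  \<open>h\<close>.\<close>

lemma card_not_splits:
  assumes S: "finite S"
  shows "card {s\<in>S. \<not> splits h S s} \<le> 2 * h"
proof -
  define L where "L = {s\<in>S. card {i\<in>S. i \<le> s} < h}"
  define R where "R = {s\<in>S. card {i\<in>S. s < i} < h}"
  have fin: "finite L" "finite R" using S by (auto simp: L_def R_def)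
  have L: "card L \<le> h"
  proof (cases "L = {}")
    case False
    then have "Max L \<in> L" using fin by simp
    moreover have "L \<subseteq> {i\<in>S. i \<le> Max L}" using fin by (auto simp: L_def)
    then have "card L \<le> card {i\<in>S. i \<le> Max L}" using S by (intro card_mono) auto
    ultimately show ?thesis by (simp add: L_def)
  qed simp
  have R: "card R \<le> h"
  proof (cases "R = {}")
    case False
    then have m: "Min R \<in> R" using fin by simp
    have "x = Min R \<or> Min R < x" if "x \<in> R" for x
      using Min_le[OF fin(2) that] by linarith
    \<comment> \<open>\<open>Min R\<close> is not counted strictly above itself; the strict
      inequality defining \<open>R\<close> makes up for this extra element.\<close>
    then have "R \<subseteq> insert (Min R) {i\<in>S. Min R < i}" by (auto simp: R_def)
    then have "card R \<le> card (insert (Min R) {i\<in>S. Min R < i})" using S by (intro card_mono) auto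
    also have "\<dots> \<le> Suc (card {i\<in>S. Min R < i})" using S by (simp add: card_insert_if)
    also have "\<dots> \<le> h" using m by (simp add: R_def)
    finally show ?thesis .
  qed simp
  have "{s\<in>S. \<not> splits h S s} = L \<union> R" by (auto simp: splits_def L_def R_def)
  then have "card {s\<in>S. \<not> splits h S s} \<le> card L + card R" by (simp add: card_Un_le)
  also have "\<dots> \<le> 2 * h" using L R by simp
  finally show ?thesis .
qed

text \<open>Each \<open>s\<close> is tested against the part that contains \<open>b s\<close>. If it
  fails, either that part is excluded, which accounts for at most \<open>2 * m\<close> indices, or
  \<open>s\<close> is one of at most \<open>2 * h\<close> bad cuts of the indices of that
  part.\<close>

lemma card_not_split_by_parts:
  assumes I: "finite I" and P: "finite P" and b: "inj_on b I" "b ` I \<subseteq> \<Union>P"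
    and E: "E \<subseteq> P" "card E \<le> 2" and m: "\<And>Y. Y \<in> P \<Longrightarrow> finite Y \<and> card Y \<le> m"
  shows "card {s\<in>I. \<not> (\<exists>Y\<in>P - E. splits h {i\<in>I. b i \<in> Y} s)} \<le> 2 * m + card P * (2 * h)"
proof -
  define S where "S Y = {i\<in>I. b i \<in> Y}" for Y
  have fS: "finite (S Y)" for Y using I by (simp add: S_def)
  have fE: "finite E" using E P finite_subset by blast
  have cS: "card (S Y) \<le> m" if "Y \<in> P" for Y
  proof -
    have "card (S Y) \<le> card Y"
      using m[OF that] b(1) by (intro card_inj_on_le[of b]) (auto simp: S_def inj_on_def)
    then show ?thesis using m[OF that] by simp
  qed
  have "{s\<in>I. \<not> (\<exists>Y\<in>P - E. splits h (S Y) s)} \<subseteq>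
      (\<Union>Y\<in>E. S Y) \<union> (\<Union>Y\<in>P. {s\<in>S Y. \<not> splits h (S Y) s})" (is "_ \<subseteq> ?A \<union> ?B")
    using b(2) by (fastforce simp: S_def)
  then have "card {s\<in>I. \<not> (\<exists>Y\<in>P - E. splits h (S Y) s)} \<le> card (?A \<union> ?B)"
    using fE P fS by (intro card_mono) auto
  also have "\<dots> \<le> card ?A + card ?B" by (rule card_Un_le)
  also have "card ?A \<le> (\<Sum>Y\<in>E. card (S Y))" by (rule card_UN_le[OF fE])
  also have "\<dots> \<le> card E * m" using sum_bounded_above[of E "\<lambda>Y. card (S Y)" m] cS E by auto
  also have "\<dots> \<le> 2 * m" using E by simp
  also have "card ?B \<le> (\<Sum>Y\<in>P. card {s\<in>S Y. \<not> splits h (S Y) s})" by (rule card_UN_le[OF P])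
  also have "\<dots> \<le> card P * (2 * h)"
    using sum_bounded_above[of P "\<lambda>Y. card {s\<in>S Y. \<not> splits h (S Y) s}" "2 * h"]
      card_not_splits[OF fS] by auto
  finally show ?thesis by (simp add: S_def)
qed

text \<open>The bad cuts for \<open>b\<close> and those for \<open>c\<close> together do not exhaust
  \<open>I\<close>. The parts \<open>Y\<close> and \<open>Z\<close> obtained from a common good cut
  may coincide.\<close>

lemma common_split_ex:
  assumes I: "finite I" and P: "finite P"
    and b: "inj_on b I" "b ` I \<subseteq> \<Union>P" and c: "inj_on c I" "c ` I \<subseteq> \<Union>P"
    and E: "E \<subseteq> P" "card E \<le> 2" and m: "\<And>Y. Y \<in> P \<Longrightarrow> finite Y \<and> card Y \<le> m"
    and large: "2 * (2 * m + card P * (2 * h)) < card I"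
  obtains s Y Z where "Y \<in> P - E" "Z \<in> P - E"
    "splits h {i\<in>I. b i \<in> Y} s" "splits h {i\<in>I. c i \<in> Z} s"
proof -
  define B where "B b = {s\<in>I. \<not> (\<exists>Y\<in>P - E. splits h {i\<in>I. b i \<in> Y} s)}" for b :: "nat \<Rightarrow> 'a"
  have "card (B b) \<le> 2 * m + card P * (2 * h)" "card (B c) \<le> 2 * m + card P * (2 * h)"
    unfolding B_def using card_not_split_by_parts[OF I P _ _ E m] b c by blast+
  then have "card (B b) + card (B c) \<le> 2 * (2 * m + card P * (2 * h))"
    by (simp only: mult_2 add_mono)
  then have "card (B b) + card (B c) < card I" using large by (rule le_less_trans)
  moreover have "card (B b \<union> B c) \<le> card (B b) + card (B c)" by (rule card_Un_le)
  ultimately have "\<not> I \<subseteq> B b \<union> B c"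
    using card_mono[of "B b \<union> B c" I] I by (auto simp: B_def)
  then show thesis using that by (auto simp: B_def)
qed

section \<open>Boxes of density 1 and 0 refute regularity\<close>

lemma K3_mono: "X' \<subseteq> X \<Longrightarrow> Y' \<subseteq> Y \<Longrightarrow> Z' \<subseteq> Z \<Longrightarrow> K3 X' Y' Z' \<subseteq> K3 X Y Z"
  unfolding K3_def by blast

text \<open>Disjointness lets the ordered triple be read off from its underlying set.\<close>

lemma card_K3:
  assumes "finite X" "finite Y" "finite Z" "X \<inter> Y = {}" "Y \<inter> Z = {}" "X \<inter> Z = {}"
  shows "card (K3 X Y Z) = card X * card Y * card Z"
proof -
  have "K3 X Y Z = (\<lambda>(x, y, z). {x, y, z}) ` (X \<times> Y \<times> Z)"
  proof (intro equalityI subsetI)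
    fix e assume "e \<in> K3 X Y Z"
    then obtain x y z where "e = {x, y, z}" "(x, y, z) \<in> X \<times> Y \<times> Z" by (auto simp: K3_def)
    then show "e \<in> (\<lambda>(x, y, z). {x, y, z}) ` (X \<times> Y \<times> Z)" by (auto intro: rev_image_eqI)
  next
    fix e assume "e \<in> (\<lambda>(x, y, z). {x, y, z}) ` (X \<times> Y \<times> Z)"
    then obtain x y z where e: "e = {x, y, z}" "x \<in> X" "y \<in> Y" "z \<in> Z" by auto
    then have "x \<noteq> y" "y \<noteq> z" "x \<noteq> z" using assms(4-6) by auto
    then show "e \<in> K3 X Y Z" using e by (auto simp: K3_def)
  qed
  moreover have "inj_on (\<lambda>(x, y, z). {x, y, z}) (X \<times> Y \<times> Z)"
  proof (rule inj_onI)
    fix p p'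
    assume "p \<in> X \<times> Y \<times> Z" "p' \<in> X \<times> Y \<times> Z"
      "(\<lambda>(x, y, z). {x, y, z}) p = (\<lambda>(x, y, z). {x, y, z}) p'"
    then obtain x y z x' y' z' where p: "p = (x, y, z)" "p' = (x', y', z')"
      and *: "x \<in> X" "y \<in> Y" "z \<in> Z" "x' \<in> X" "y' \<in> Y" "z' \<in> Z" "{x, y, z} = {x', y', z'}"
      by auto
    have "x \<noteq> y'" "x \<noteq> z'" "y \<noteq> x'" "y \<noteq> z'" "z \<noteq> x'" "z \<noteq> y'"
      using *(1-6) assms(4-6) by auto
    moreover have "x \<in> {x', y', z'}" "y \<in> {x', y', z'}" "z \<in> {x', y', z'}"
      unfolding *(7)[symmetric] by simp_all
    ultimately show "p = p'" by (simp add: p)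
  qed
  ultimately show ?thesis by (simp add: card_image card_cartesian_product)
qed

text \<open>Each box fills at least a \<open>1 / q ^ 3\<close> share of the whole. The box of
  density 1 forces \<open>1 - d \<le> \<epsilon> * q ^ 3\<close>, the box of density 0 forces
  \<open>d \<le> \<epsilon> * q ^ 3\<close>, and adding the two contradicts
  \<open>2 * \<epsilon> * q ^ 3 < 1\<close>.\<close>

lemma not_vdisc3:
  fixes \<epsilon> q :: real
  assumes fin: "finite X" "finite Y" "finite Z" and ne: "X \<noteq> {}" "Y \<noteq> {}" "Z \<noteq> {}"
    and sub: "X' \<subseteq> X" "Y1 \<subseteq> Y" "Y2 \<subseteq> Y" "Z1 \<subseteq> Z" "Z2 \<subseteq> Z"
    and full: "\<And>x y z. x \<in> X' \<Longrightarrow> y \<in> Y1 \<Longrightarrow> z \<in> Z1 \<Longrightarrow> {x, y, z} \<in> F"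
    and empty: "\<And>x y z. x \<in> X' \<Longrightarrow> y \<in> Y2 \<Longrightarrow> z \<in> Z2 \<Longrightarrow> {x, y, z} \<notin> F"
    and q: "card X \<le> q * card X'" "card Y \<le> q * card Y1" "card Y \<le> q * card Y2"
      "card Z \<le> q * card Z1" "card Z \<le> q * card Z2"
    and \<epsilon>: "\<epsilon> > 0" "2 * \<epsilon> * q ^ 3 < 1"
  shows "\<not> vdisc3 \<epsilon> X Y Z (F \<inter> K3 X Y Z)"
proof
  assume vd: "vdisc3 \<epsilon> X Y Z (F \<inter> K3 X Y Z)"
  then have disj: "X \<inter> Y = {}" "Y \<inter> Z = {}" "X \<inter> Z = {}"
    by (simp_all add: vdisc3_def tripartite_def)
  obtain d where d: "\<forall>U' V' W'. U' \<subseteq> X \<and> V' \<subseteq> Y \<and> W' \<subseteq> Z \<longrightarrow>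
      \<bar>real (card (F \<inter> K3 X Y Z \<inter> K3 U' V' W')) - d * real (card U') * real (card V') * real (card W')\<bar>
        \<le> \<epsilon> * real (card X) * real (card Y) * real (card Z)"
    using vd unfolding vdisc3_def by (elim conjE exE)
  have box: "real (card X) * real (card Y) * real (card Z) \<le> q ^ 3 * (card X' * card Y' * card Z')
      \<and> 0 < real (card X' * card Y' * card Z')"
    if Y': "card Y \<le> q * card Y'" and Z': "card Z \<le> q * card Z'" for Y' Z' :: "'a set"
  proof -
    have pos: "0 < real (card X)" "0 < real (card Y)" "0 < real (card Z)"
      using fin ne by (auto simp: card_gt_0_iff)
    have "real (card X) * real (card Y) * real (card Z) \<le>
        (q * card X') * (q * card Y') * (q * card Z')"
      using q(1) Y' Z' pos by (intro mult_mono) auto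
    moreover have "0 < real (card S')" if "card S \<le> q * card S'" "0 < real (card S)" for S S' :: "'a set"
      using that by (cases "card S' = 0") auto
    then have "0 < real (card X')" "0 < real (card Y')" "0 < real (card Z')"
      using q(1) Y' Z' pos by blast+
    ultimately show ?thesis by (simp add: power3_eq_cube mult_ac)
  qed
  have "F \<inter> K3 X Y Z \<inter> K3 X' Y1 Z1 = K3 X' Y1 Z1"
  proof -
    have "K3 X' Y1 Z1 \<subseteq> K3 X Y Z" using sub by (intro K3_mono)
    moreover have "K3 X' Y1 Z1 \<subseteq> F" using full by (auto simp: K3_def)
    ultimately show ?thesis by blast
  qed
  moreover have "card (K3 X' Y1 Z1) = card X' * card Y1 * card Z1"
    using sub fin disj by (intro card_K3) (auto intro: finite_subset)
  ultimately have "\<bar>real (card X' * card Y1 * card Z1) * (1 - d)\<bar>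
      \<le> \<epsilon> * (real (card X) * real (card Y) * real (card Z))"
    using d[rule_format, of X' Y1 Z1] sub by (simp add: algebra_simps)
  also have "\<dots> \<le> \<epsilon> * (q ^ 3 * (card X' * card Y1 * card Z1))"
    using box[OF q(2,4)] \<epsilon>(1) by (intro mult_left_mono) auto
  finally have "real (card X' * card Y1 * card Z1) * (1 - d) \<le> real (card X' * card Y1 * card Z1) * (\<epsilon> * q ^ 3)"
    by (simp add: algebra_simps)
  then have 1: "1 - d \<le> \<epsilon> * q ^ 3"
    using box[OF q(2,4)] by (simp only: mult_le_cancel_left_pos)
  have "{x, y, z} \<notin> F" if "x \<in> X'" "y \<in> Y2" "z \<in> Z2" for x y z using empty that by blast
  then have "F \<inter> K3 X Y Z \<inter> K3 X' Y2 Z2 = {}"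
    by (auto simp: K3_def)
  then have "\<bar>real (card X' * card Y2 * card Z2) * d\<bar>
      \<le> \<epsilon> * (real (card X) * real (card Y) * real (card Z))"
    using d[rule_format, of X' Y2 Z2] sub by (simp add: algebra_simps)
  also have "\<dots> \<le> \<epsilon> * (q ^ 3 * (card X' * card Y2 * card Z2))"
    using box[OF q(3,5)] \<epsilon>(1) by (intro mult_left_mono) auto
  finally have "real (card X' * card Y2 * card Z2) * d \<le> real (card X' * card Y2 * card Z2) * (\<epsilon> * q ^ 3)"
    by (simp add: algebra_simps)
  then have "d \<le> \<epsilon> * q ^ 3"
    using box[OF q(3,5)] by (simp only: mult_le_cancel_left_pos)
  with 1 \<epsilon>(2) show False by linarith
qed

section \<open>Conflicting boxes in any bounded equipartition\<close>

theorem theorem2p39: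
  fixes \<H> :: "'v hgraph set"
  assumes "hereditary_property \<H>"
    and "\<And>k::nat. k \<ge> 1 \<Longrightarrow> in_Trip (Hbar k) \<H>"
  shows "\<not> admits_zero_vdisc3_error \<H>"
proof
  assume zero: "admits_zero_vdisc3_error \<H>"
  \<comment> \<open>All boxes will be used with \<open>q = 100\<close>, and then
    \<open>2 * \<epsilon> * q ^ 3 = 1 / 5\<close>.\<close>
  define \<epsilon> :: real where "\<epsilon> = 1 / 10 ^ 7"
  have "\<epsilon> > 0 \<and> (100::nat) \<ge> 1" by (simp add: \<epsilon>_def)
  then obtain T N where TN: "\<And>V F. (V, F) \<in> \<H> \<Longrightarrow> card V \<ge> N \<Longrightarrow>
      \<exists>P. equipartition V P \<and> 100 \<le> card P \<and> card P \<le> T \<and>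
        (\<forall>X\<in>P. \<forall>Y\<in>P. \<forall>Z\<in>P. X \<noteq> Y \<and> Y \<noteq> Z \<and> X \<noteq> Z \<longrightarrow> vdisc3 \<epsilon> X Y Z (F \<inter> K3 X Y Z))"
    using zero unfolding admits_zero_vdisc3_error_def by meson
  \<comment> \<open>The summand \<open>N\<close> makes the graph large enough for the partition to
    exist. The summand \<open>100 * T\<close> keeps every part at 100 vertices or more, since
    otherwise at most \<open>T\<close> parts could not cover \<open>V\<close>.\<close>
  define k where "k = N + 100 * T + 1"
  have k1: "k \<ge> 1" by (simp add: k_def)
  then have "in_Trip (Hbar (27 * k)) \<H>" using assms(2) by simp
  from in_Trip_HbarE[OF assms(1) k1 this]
  obtain I :: "nat set" and a b c :: "nat \<Rightarrow> 'v" and F where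
    H: "(a ` I \<union> b ` I \<union> c ` I, F) \<in> \<H>" and I: "finite I" "k \<le> card I"
    and inj: "inj_on a I" "inj_on b I" "inj_on c I"
    and edge: "\<And>u v w. u \<in> I \<Longrightarrow> v \<in> I \<Longrightarrow> w \<in> I \<Longrightarrow> {a u, b v, c w} \<in> F \<longleftrightarrow> v \<le> w"
    by metis
  define V where "V = a ` I \<union> b ` I \<union> c ` I"
  have finV: "finite V" using I by (simp add: V_def)
  have "card (a ` I) \<le> card V" using finV by (intro card_mono) (auto simp: V_def)
  then have cV: "card I \<le> card V" using inj by (simp add: card_image)
  have "card V \<le> card (a ` I) + card (b ` I) + card (c ` I)"
    unfolding V_def by (meson add_le_mono card_Un_le le_refl order_trans)
  then have cV3: "card V \<le> 3 * card I" using inj by (simp add: card_image)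
  have "card V \<ge> N" using cV I(2) by (simp add: k_def)
  from TN[OF H[folded V_def] this]
  obtain P where P: "equipartition V P \<and> 100 \<le> card P \<and> card P \<le> T \<and>
      (\<forall>X\<in>P. \<forall>Y\<in>P. \<forall>Z\<in>P. X \<noteq> Y \<and> Y \<noteq> Z \<and> X \<noteq> Z \<longrightarrow> vdisc3 \<epsilon> X Y Z (F \<inter> K3 X Y Z))"
    by (elim exE)
  then have eq: "equipartition V P" and t: "100 \<le> card P" "card P \<le> T" by simp_all
  have vd: "vdisc3 \<epsilon> X Y Z (F \<inter> K3 X Y Z)"
    if "X \<in> P" "Y \<in> P" "Z \<in> P" "X \<noteq> Y" "Y \<noteq> Z" "X \<noteq> Z" for X Y Z
    using P that by simp
  have part: "partition_on V P" and near: "\<And>X Y. X \<in> P \<Longrightarrow> Y \<in> P \<Longrightarrow> card X \<le> card Y + 1"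
    using eq by (auto simp: equipartition_def)
  have UP: "\<Union>P = V" and neP: "\<And>Y. Y \<in> P \<Longrightarrow> Y \<noteq> {}" and disjP: "disjoint P"
    using part by (auto simp: partition_on_def)
  have finP: "finite P" using finite_elements[OF finV part] .
  have finY: "finite Y" if "Y \<in> P" for Y
    using that UP finV by (metis Union_upper finite_subset)
  define p where "p = Min (card ` P)"
  have "P \<noteq> {}" using t by auto
  then have "p \<in> card ` P" using finP by (simp add: p_def)
  then have pY: "p \<le> card Y" "card Y \<le> p + 1" if "Y \<in> P" for Y
    using that near finP by (auto simp: p_def)
  have sum_parts: "(\<Sum>Y\<in>P. card (Y \<inter> A)) = card A" if "A \<subseteq> V" for A
  proof -
    have "card (\<Union>Y\<in>P. Y \<inter> A) = (\<Sum>Y\<in>P. card (Y \<inter> A))"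
      using finP finY disjP by (intro card_UN_disjoint) (auto simp: disjoint_def)
    moreover have "(\<Union>Y\<in>P. Y \<inter> A) = A" using that UP by blast
    ultimately show ?thesis by simp
  qed
  have "(\<Sum>Y\<in>P. card Y) = (\<Sum>Y\<in>P. card (Y \<inter> V))"
    using UP by (intro sum.cong refl arg_cong[of _ _ card]) auto
  then have sumV: "(\<Sum>Y\<in>P. card Y) = card V" using sum_parts by simp
  have tp: "card P * p \<le> card V"
    using sum_bounded_below[of P p card] pY sumV by simp
  have tp1: "card V \<le> card P * (p + 1)"
    using sum_bounded_above[of P card "p + 1"] pY sumV by simp
  have p100: "100 \<le> p"
  proof (rule ccontr)
    assume "\<not> 100 \<le> p"
    then have "card P * (p + 1) \<le> T * 100" using t by (intro mult_mono) auto
    then show False using tp1 cV I(2) by (simp add: k_def)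
  qed
  \<comment> \<open>The divisor 24 makes the bad cuts, at most \<open>2 * h\<close> per part, number
    at most a twelfth of \<open>card V\<close>, hence at most a quarter of \<open>card I\<close>.
    Still \<open>h\<close> is at least a hundredth of every part, because \<open>p\<close> is at
    least 100.\<close>
  define h where "h = p div 24"
  have h: "24 * h \<le> p" "p + 1 \<le> 100 * h" using p100 by (auto simp: h_def)
  \<comment> \<open>With at least 100 parts, two excluded parts are a small share of
    \<open>V\<close>. As \<open>card V\<close> is at most \<open>3 * card I\<close>, both losses,
    counted once for \<open>b\<close> and once for \<open>c\<close>, stay below
    \<open>card I\<close>.\<close>
  have large: "2 * (2 * (p + 1) + card P * (2 * h)) < card I"
  proof -
    have "100 * p \<le> card P * p" using t by simp
    moreover have "12 * (card P * (2 * h)) \<le> card P * p" using h by simp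
    moreover have "2 * (2 * (p + 1) + n) < card I"
      if "100 * p \<le> m" "12 * n \<le> m" "m \<le> 3 * card I" for m n
      using that p100 by simp
    ultimately show ?thesis using tp cV3 by (meson order_trans)
  qed
  \<comment> \<open>Averaging over the parts: the image of \<open>a\<close> has at least a third of
    all vertices.\<close>
  have "\<exists>X\<in>P. card X \<le> 3 * card (X \<inter> a ` I)"
  proof (rule ccontr)
    assume "\<not> ?thesis"
    then have "(\<Sum>X\<in>P. 3 * card (X \<inter> a ` I)) < (\<Sum>X\<in>P. card X)"
      using finP \<open>P \<noteq> {}\<close> by (intro sum_strict_mono) auto
    moreover have "a ` I \<subseteq> V" by (auto simp: V_def)
    then have "(\<Sum>X\<in>P. 3 * card (X \<inter> a ` I)) = 3 * card I"
      using sum_parts[of "a ` I"] inj by (simp add: card_image flip: sum_distrib_left)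
    ultimately show False using sumV cV3 by simp
  qed
  then obtain X where X: "X \<in> P" "card X \<le> 3 * card (X \<inter> a ` I)" by blast
  \<comment> \<open>The first coordinate of both boxes is the set of all \<open>a u\<close> in
    \<open>X\<close>, since edges of the pattern do not depend on \<open>u\<close>.\<close>
  have conflict: False
    if YZ: "Y \<in> P - {X}" "Z \<in> P - {X}" "Y \<noteq> Z"
      and sub: "Y1 \<subseteq> Y" "Y2 \<subseteq> Y" "Z1 \<subseteq> Z" "Z2 \<subseteq> Z"
      and big: "h \<le> card Y1" "h \<le> card Y2" "h \<le> card Z1" "h \<le> card Z2"
      and full: "\<And>u y z. u \<in> I \<Longrightarrow> y \<in> Y1 \<Longrightarrow> z \<in> Z1 \<Longrightarrow> {a u, y, z} \<in> F"
      and empty: "\<And>u y z. u \<in> I \<Longrightarrow> y \<in> Y2 \<Longrightarrow> z \<in> Z2 \<Longrightarrow> {a u, y, z} \<notin> F"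
    for Y Z Y1 Y2 Z1 Z2
  proof -
    have q: "real (card Y) \<le> 100 * real (card Y')" if "Y \<in> P" "h \<le> card Y'" for Y Y' :: "'v set"
      using pY(2)[OF that(1)] h that by linarith
    have "real (card X) \<le> 100 * real (card (X \<inter> a ` I))" using X(2) by linarith
    then have "\<not> vdisc3 \<epsilon> X Y Z (F \<inter> K3 X Y Z)"
      using YZ X(1) sub big full empty finY neP q
      by (intro not_vdisc3[of X Y Z "X \<inter> a ` I" Y1 Y2 Z1 Z2 F 100]) (auto simp: \<epsilon>_def)
    then show False using vd[of X Y Z] YZ X(1) by auto
  qed
  have bigB: "h \<le> card (b ` {i\<in>{i\<in>I. b i \<in> Y}. i \<le> s})" "h \<le> card (b ` {i\<in>{i\<in>I. b i \<in> Y}. s < i})"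
    if "splits h {i\<in>I. b i \<in> Y} s" for Y s
    using that inj(2) by (auto simp: splits_def card_image inj_on_def)
  have bigC: "h \<le> card (c ` {i\<in>{i\<in>I. c i \<in> Y}. i \<le> s})" "h \<le> card (c ` {i\<in>{i\<in>I. c i \<in> Y}. s < i})"
    if "splits h {i\<in>I. c i \<in> Y} s" for Y s
    using that inj(3) by (auto simp: splits_def card_image inj_on_def)
  have cover: "b ` I \<subseteq> \<Union>P" "c ` I \<subseteq> \<Union>P" by (auto simp: UP V_def)
  have split_one: "\<exists>s. \<exists>Y\<in>P - E. splits h {i\<in>I. b i \<in> Y} s \<and> splits h {i\<in>I. c i \<in> Y} s"
    if E: "E \<subseteq> P" "card E \<le> 2" "X \<in> E" for E
  proof -
    obtain s Y Z where YZ: "Y \<in> P - E" "Z \<in> P - E"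
      and b: "splits h {i\<in>I. b i \<in> Y} s" and c: "splits h {i\<in>I. c i \<in> Z} s"
      by (rule common_split_ex[OF I(1) finP inj(2) cover(1) inj(3) cover(2) E(1,2) _ large])
        (use finY pY(2) in blast)+
    \<comment> \<open>If the parts differed, \<open>b\<close> up to \<open>s\<close> against
      \<open>c\<close> beyond \<open>s\<close> would give a full box, and \<open>b\<close> beyond
      \<open>s\<close> against \<open>c\<close> up to \<open>s\<close> an empty one.\<close>
    have "Y = Z"
    proof (rule ccontr)
      assume "Y \<noteq> Z"
      then show False
        using YZ E(3) edge
        by (intro conflict[OF _ _ _ _ _ _ _ bigB[OF b] bigC(2)[OF c] bigC(1)[OF c]]) auto
    qed
    then show ?thesis using YZ b c by blast
  qed
  obtain s Y where Y: "Y \<in> P - {X}" "splits h {i\<in>I. b i \<in> Y} s" "splits h {i\<in>I. c i \<in> Y} s"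
    using split_one[of "{X}"] X by auto
  \<comment> \<open>Excluding \<open>Y\<close> as well as \<open>X\<close> forces a new part; this
    is why the cut lemmas allow two exclusions.\<close>
  have "card {X, Y} \<le> 2" by (cases "X = Y") auto
  then obtain s' Z where Z: "Z \<in> P - {X, Y}" "splits h {i\<in>I. b i \<in> Z} s'" "splits h {i\<in>I. c i \<in> Z} s'"
    using split_one[of "{X, Y}"] X Y by blast
  \<comment> \<open>For \<open>s \<le> s'\<close>, indices up to \<open>s\<close> are smaller than
    indices beyond \<open>s'\<close>. So \<open>Y\<close> supplies its lower halves and
    \<open>Z\<close> its upper halves: \<open>b\<close> in \<open>Y\<close> with \<open>c\<close> in
    \<open>Z\<close> is full, while \<open>c\<close> in \<open>Y\<close> with \<open>b\<close> in
    \<open>Z\<close> is empty.\<close>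
  have False
    if "s \<le> s'" "Y \<in> P - {X}" "Z \<in> P - {X}" "Y \<noteq> Z"
      "splits h {i\<in>I. b i \<in> Y} s" "splits h {i\<in>I. c i \<in> Y} s"
      "splits h {i\<in>I. b i \<in> Z} s'" "splits h {i\<in>I. c i \<in> Z} s'" for s s' Y Z
  proof (rule conflict[OF that(2-4) _ _ _ _ bigB(1)[OF that(5)] bigC(1)[OF that(6)]
        bigC(2)[OF that(8)] bigB(2)[OF that(7)]])
    fix u y z
    assume "u \<in> I" "y \<in> c ` {i \<in> {i \<in> I. c i \<in> Y}. i \<le> s}" "z \<in> b ` {i \<in> {i \<in> I. b i \<in> Z}. s' < i}"
    then obtain v w where vw: "y = c w" "z = b v" "w \<in> I" "v \<in> I" "w \<le> s" "s' < v" by blast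
    then have "w < v" using that(1) by simp
    then show "{a u, y, z} \<notin> F"
      using edge[of u v w] \<open>u \<in> I\<close> vw by (simp add: insert_commute)
  qed (use edge that(1) in auto)
  \<comment> \<open>The two cuts come in an unknown order; if \<open>s'\<close> is smaller, the two
    parts exchange roles.\<close>
  from this[of s s' Y Z] this[of s' s Z Y] show False
    using Y Z by fastforce
qed

end
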